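(* Let $f:\overline{\mathbf{B}}^n\to\mathbb{R}$ be a $C^k$ function, $k\ge2$, with $\|f\|_{C^k}\le K$. Suppose that $f$ is a Morse function with the critical locus $\Sigma(f)=\{x_1,\ldots,x_p\}$ contained in $\mathbf{B}^n$ and has distinct critical values. Let $$\gamma=\min\{\sigma_n(Hf(x)):x\in\Sigma(f)\},\qquad d=\min\{|f(x_i)-f(x_j)|:i\ne j,\ i,j=1,\ldots,p\},$$ $$\rho=\min\left(\frac{\gamma^2}{128K^2},\ \frac{d}{8K},\ d(\Sigma(f),\partial\mathbf{B}^n)\right),\qquad\eta=\inf\{\|Df(x)\|:x\in\overline{\mathbf{B}}^n,\ d(x,\Sigma(f))\ge\rho\}.$$ Let $\varepsilon=\min\left(\frac\eta2,\frac{\gamma^2}{64K},\frac d4\right)$. Then every $C^k$ function $\bar f:\overline{\mathbf{B}}^n\to\mathbb{R}$ with $\|\bar f-f\|_{C^k}<\varepsilon$ satisfies the following: (i) If $x\in\mathbf{B}^n$ and $\|D\bar f(x)\|<\frac\eta2$, then $\sigma_n(H\bar f(x))\ge\frac\gamma2$. In particular, $\bar f$ is a Morse function. (ii) $\Sigma(\bar f)=\{\bar x_1,\ldots,\bar x_p\}\subset\mathbf{B}^n$, and $\|\bar x_i-x_i\|<\rho$ for $i=1,\ldots,p$. (iii) $\sigma_n(H\bar f(\bar x_i))\ge\frac\gamma2$ for $i=1,\ldots,p$. (iv) $\min\{|\bar f(\bar x_i)-\bar f(\bar x_j)|:i\ne j,\ i,j=1,\ldots,p\}\ge\frac d2$.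
   Context: $\mathbf{B}^n$ is the unit ball of $\mathbb{R}^n$ centered at $0$ (Euclidean norm), $\overline{\mathbf{B}}^n$ its closure, $\partial\mathbf{B}^n$ its boundary sphere; $d(\cdot,\cdot)$ with point or set arguments is the Euclidean distance. For a $C^k$ mapping $f$ on a domain $U$, $\|f\|_{C^k}=\max_{1\le p\le k}\sup_{x\in U}\|D^pf(x)\|$, with operator norms (the values of $f$ itself are not included). $\Sigma(f)$ is the set of critical points of $f$ (points with $Df(x)=0$); $Hf(x)$ is the Hessian of $f$ at $x$; $\sigma_n(L)=\min_{\|x\|=1}\|Lx\|$ is the smallest singular value of an $n\times n$ matrix $L$. A $C^k$ function ($k\ge2$) is called Morse if $Hf(x)$ is nondegenerate, i.e. $\sigma_n(Hf(x))>0$, at every critical point $x$. Having distinct critical values means $f(x_i)\ne f(x_j)$ for $i\ne j$.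
   Formalization: For k = 2 the formal theorem additionally assumes that Hf is K-Lipschitz on the closed ball in operator norm; without this the claim is false for k = 2. For k ≥ 3 it is as stated. *)

theory Defs
  imports "HOL-Analysis.Analysis"
begin

(* Functions on the closed ball are total functions of which only the values on
   S = cball 0 1 matter: all derivatives are taken "at x within S".  A convex set
   with nonempty interior determines these derivatives uniquely, also at boundary
   points. *)

abbreviation D_on :: "'a::real_normed_vector set \<Rightarrow> ('a \<Rightarrow> real) \<Rightarrow> 'a \<Rightarrow> 'a \<Rightarrow> real" where
  "D_on S f x \<equiv> frechet_derivative f (at x within S)"

(* iterated_D S f [v1, ..., vp] x is D^p f(x)(v1, ..., vp). *)
fun iterated_D :: "'a::real_normed_vector set \<Rightarrow> ('a \<Rightarrow> real) \<Rightarrow> 'a list \<Rightarrow> 'a \<Rightarrow> real" where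
  "iterated_D S f [] = f"
| "iterated_D S f (v # vs) = (\<lambda>x. D_on S (iterated_D S f vs) x v)"

(* The target space of D^p f depends on p, so continuity of the map x |-> Df(x) is
   expressed through all of its evaluations x |-> Df(x)(v); in finite dimension this
   is continuity in operator norm. *)
fun Ck_on :: "nat \<Rightarrow> 'a::euclidean_space set \<Rightarrow> ('a \<Rightarrow> real) \<Rightarrow> bool" where
  "Ck_on 0 S f \<longleftrightarrow> continuous_on S f"
| "Ck_on (Suc k) S f \<longleftrightarrow>
     f differentiable_on S \<and> (\<forall>v. Ck_on k S (\<lambda>x. D_on S f x v))"

definition norm_Dp :: "'a::real_normed_vector set \<Rightarrow> ('a \<Rightarrow> real) \<Rightarrow> nat \<Rightarrow> 'a \<Rightarrow> ereal" where
  "norm_Dp S f p x =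
     (SUP vs\<in>{vs. length vs = p \<and> (\<forall>v\<in>set vs. norm v \<le> 1)}. ereal \<bar>iterated_D S f vs x\<bar>)"

(* The values of f itself (p = 0) do not enter, so this is only a seminorm. *)
definition Ck_norm :: "nat \<Rightarrow> 'a::real_normed_vector set \<Rightarrow> ('a \<Rightarrow> real) \<Rightarrow> ereal" where
  "Ck_norm k S f = (MAX p\<in>{1..k}. SUP x\<in>S. norm_Dp S f p x)"

definition critical_points :: "'a::real_normed_vector set \<Rightarrow> ('a \<Rightarrow> real) \<Rightarrow> 'a set" where
  "critical_points S f = {x \<in> S. D_on S f x = (\<lambda>v. 0)}"

definition hessian :: "(real^'n) set \<Rightarrow> (real^'n \<Rightarrow> real) \<Rightarrow> real^'n \<Rightarrow> real^'n^'n" where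
  "hessian S f x = (\<chi> i j. iterated_D S f [axis i 1, axis j 1] x)"

definition sigma_min :: "real^'n^'n \<Rightarrow> real" where
  "sigma_min L = (INF x\<in>sphere 0 1. norm (L *v x))"

definition morse_on :: "(real^'n) set \<Rightarrow> (real^'n \<Rightarrow> real) \<Rightarrow> bool" where
  "morse_on S f \<longleftrightarrow> (\<forall>x\<in>critical_points S f. sigma_min (hessian S f x) > 0)"

(* Lipschitz condition in operator norm (the norm of real^'n^'n is the Frobenius norm).
   On a convex S it follows from Ck_norm k S f \<le> K as soon as k \<ge> 3, but not for k = 2. *)
definition hessian_lipschitz_on :: "real \<Rightarrow> (real^'n) set \<Rightarrow> (real^'n \<Rightarrow> real) \<Rightarrow> bool" where
  "hessian_lipschitz_on K S f \<longleftrightarrow>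
     (\<forall>x\<in>S. \<forall>y\<in>S. onorm ((*v) (hessian S f x - hessian S f y)) \<le> K * dist x y)"

(* Distances and minima are extended reals, so that those over an empty set are \<infinity>
   (infdist and setdist are 0 there). *)
definition dist_set :: "'a::metric_space \<Rightarrow> 'a set \<Rightarrow> ereal" where
  "dist_set x A = (INF y\<in>A. ereal (dist x y))"

definition dist_sets :: "'a::metric_space set \<Rightarrow> 'a set \<Rightarrow> ereal" where
  "dist_sets A B = (INF x\<in>A. dist_set x B)"

(* The least gap |f (x i) - f (x j)|, 1 \<le> i \<noteq> j \<le> p; it is \<infinity> if p \<le> 1. *)
definition min_gap :: "('a \<Rightarrow> real) \<Rightarrow> (nat \<Rightarrow> 'a) \<Rightarrow> nat \<Rightarrow> ereal" where
  "min_gap f x p =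
     (INF (i, j)\<in>{(i, j). i \<in> {1..p} \<and> j \<in> {1..p} \<and> i \<noteq> j}. ereal \<bar>f (x i) - f (x j)\<bar>)"

end

theory Submission
  imports Defs
begin

text \<open>
  A point with \<open>|Dg| < \<eta>/2\<close> has \<open>|Df| < \<eta>\<close>, hence lies within \<open>\<rho>\<close> of a critical point \<open>s\<close> of \<open>f\<close>, and
  there \<open>Hg\<close> differs from \<open>Hf(s)\<close> by at most \<open>K \<rho> + \<epsilon>\<close>, a small fraction of \<open>\<gamma>\<close>. Since \<open>Dg\<close> is then
  injective on the \<open>\<rho>\<close>-ball about \<open>s\<close>, that ball contains at most one critical point of \<open>g\<close>; it contains
  one because \<open>|\<nabla>g|\<close> is below \<open>\<eta>/2\<close> at \<open>s\<close> and at least \<open>\<eta>/2\<close> on the boundary of the ball.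
  The critical values move little because \<open>\<eta> \<le> K \<rho>\<close>, which makes \<open>\<epsilon> \<le> d/16\<close>; the bound \<open>\<epsilon> \<le> d/4\<close> from
  the definition of \<open>\<epsilon>\<close> would not suffice.
\<close>

section \<open>Derivatives within a convex set with interior points\<close>

text \<open>Along the segment from x to a point u of S the derivative is that of a function of one
  real variable, so all candidates agree on u - x. Since S contains a ball, every vector is a
  multiple of a difference of two such u - x.\<close>

lemma has_derivative_within_convex_unique:
  fixes f :: "'a::real_normed_vector \<Rightarrow> 'b::real_normed_vector"
  assumes "convex S" "interior S \<noteq> {}" "x \<in> S"
    and L: "(f has_derivative L) (at x within S)"
    and M: "(f has_derivative M) (at x within S)"
  shows "L = M"
proof -
  have ray: "((\<lambda>t::real. f (x + t *\<^sub>R (u - x))) has_derivative (\<lambda>t. N (t *\<^sub>R (u - x)))) (at 0 within {0..1})"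
    if u: "u \<in> S" and N: "(f has_derivative N) (at x within S)" for u N
  proof -
    have "(\<lambda>t::real. x + t *\<^sub>R (u - x)) ` {0..1} \<subseteq> S"
    proof clarify
      fix t :: real assume "t \<in> {0..1}"
      moreover have "x + t *\<^sub>R (u - x) = (1 - t) *\<^sub>R x + t *\<^sub>R u"
        by (simp add: algebra_simps)
      ultimately show "x + t *\<^sub>R (u - x) \<in> S"
        using convexD_alt[OF assms(1) assms(3) u] by simp
    qed
    then have "(f has_derivative N) (at (x + 0 *\<^sub>R (u - x)) within (\<lambda>t::real. x + t *\<^sub>R (u - x)) ` {0..1})"
      using N by (simp add: has_derivative_subset)
    then show ?thesis
      by (rule has_derivative_in_compose[rotated]) (auto intro!: derivative_eq_intros)
  qed
  have lin: "linear L" "linear M"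
    using L M by (auto intro: has_derivative_linear)
  have towards: "L (u - x) = M (u - x)" if u: "u \<in> S" for u
  proof (rule vector_derivative_unique_within)
    show "at (0::real) within {0..1} \<noteq> bot"
      by (simp add: trivial_limit_within islimpt_Icc)
    show "((\<lambda>t. f (x + t *\<^sub>R (u - x))) has_vector_derivative L (u - x)) (at 0 within {0..1})"
      using ray[OF u L] lin by (simp add: has_vector_derivative_def linear_scale)
    show "((\<lambda>t. f (x + t *\<^sub>R (u - x))) has_vector_derivative M (u - x)) (at 0 within {0..1})"
      using ray[OF u M] lin by (simp add: has_vector_derivative_def linear_scale)
  qed
  obtain a e where e: "e > 0" "ball a e \<subseteq> S"
    using assms(2) by (metis ex_in_conv mem_interior)
  show "L = M"
  proof
    fix v :: 'a
    \<comment> \<open>Scales v so that a + s v stays in the ball; the summand 1 covers v =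
      0.\<close>
    define s where "s = e / (2 * (norm v + 1))"
    have s: "s > 0" "s * norm v < e"
    proof -
      show "s > 0" using e by (simp add: s_def add_nonneg_pos)
      have "0 < 2 * (norm v + 1)" "norm v < 2 * (norm v + 1)"
        using norm_ge_zero[of v] by (auto intro: add_nonneg_pos)
      then have "norm v / (2 * (norm v + 1)) < 1"
        by (subst pos_divide_less_eq) simp_all
      then show "s * norm v < e" using e
        using mult_strict_left_mono[of "norm v / (2 * (norm v + 1))" 1 e] by (simp add: s_def)
    qed
    then have "a \<in> S" "a + s *\<^sub>R v \<in> S"
      using e by (auto simp: subset_iff dist_norm)
    then have "L (a + s *\<^sub>R v - x) - L (a - x) = M (a + s *\<^sub>R v - x) - M (a - x)"
      by (simp add: towards)
    then have "s *\<^sub>R L v = s *\<^sub>R M v"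
      using lin by (simp add: linear_diff linear_add linear_scale)
    then show "L v = M v" using s by simp
  qed
qed

lemma D_on_eq:
  assumes "convex S" "interior S \<noteq> {}" "x \<in> S" "(f has_derivative L) (at x within S)"
  shows "D_on S f x = L"
  using has_derivative_within_convex_unique[OF assms(1-3) _ assms(4)]
    frechet_derivative_works differentiableI[OF assms(4)] by blast

section \<open>Bounds for derivatives of C^k functions\<close>

lemma Ck_on_2D:
  assumes "Ck_on k S f" "k \<ge> 2"
  shows "f differentiable_on S" "(\<lambda>x. D_on S f x v) differentiable_on S"
proof -
  obtain m where "k = Suc (Suc m)" using assms(2) by (metis add_2_eq_Suc le_Suc_ex)
  then show "f differentiable_on S" "(\<lambda>x. D_on S f x v) differentiable_on S"
    using assms(1) by auto
qed

lemma Ck_on_3D: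
  assumes "Ck_on k S f" "k \<ge> 3"
  shows "iterated_D S f [v, w] differentiable_on S"
proof -
  obtain m where "k = Suc (Suc (Suc m))" using assms(2)
    by (metis add_Suc le_Suc_ex numeral_3_eq_3 plus_nat.simps(1))
  then show ?thesis
    using assms(1) by auto
qed

lemma differentiable_onD_has_derivative:
  assumes "f differentiable_on S" "x \<in> S"
  shows "(f has_derivative D_on S f x) (at x within S)"
  using assms frechet_derivative_works by (auto simp: differentiable_on_def)

lemma Ck_normD:
  assumes "Ck_norm k S f \<le> ereal C" "x \<in> S" "vs \<noteq> []" "length vs \<le> k" "\<forall>v\<in>set vs. norm v \<le> 1"
  shows "\<bar>iterated_D S f vs x\<bar> \<le> C"
proof -
  have "ereal \<bar>iterated_D S f vs x\<bar> \<le> norm_Dp S f (length vs) x"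
    unfolding norm_Dp_def using assms by (intro SUP_upper) auto
  also have "\<dots> \<le> (SUP x\<in>S. norm_Dp S f (length vs) x)"
    using assms by (intro SUP_upper)
  also have "\<dots> \<le> Ck_norm k S f"
    unfolding Ck_norm_def using assms by (intro Max_ge) (auto simp: Suc_le_eq)
  finally show ?thesis using assms(1) by (metis ereal_less_eq(3) order_trans)
qed

lemma linear_unit_bound:
  fixes L :: "'a::real_normed_vector \<Rightarrow> 'b::real_normed_vector"
  assumes "linear L" "\<And>v. norm v \<le> 1 \<Longrightarrow> norm (L v) \<le> C"
  shows "norm (L v) \<le> C * norm v"
proof (cases "v = 0")
  case True
  then show ?thesis using assms(1) by (simp add: linear_0)
next
  case False
  then have "norm (L (v /\<^sub>R norm v)) \<le> C" by (intro assms(2)) simp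
  then show ?thesis using False assms(1) by (simp add: linear_scale field_simps)
qed

lemma D_on_bound:
  assumes "f differentiable_on S" "Ck_norm k S f \<le> ereal C" "k \<ge> 1" "x \<in> S"
  shows "\<bar>D_on S f x v\<bar> \<le> C * norm v"
proof -
  have "linear (D_on S f x)"
    using assms by (intro linear_frechet_derivative) (auto simp: differentiable_on_def)
  moreover have "norm (D_on S f x v) \<le> C" if "norm v \<le> 1" for v
    using Ck_normD[OF assms(2,4), of "[v]"] assms(3) that by simp
  ultimately show ?thesis using linear_unit_bound[of "D_on S f x" C v] by simp
qed

section \<open>The Hessian as second derivative\<close>

text \<open>\<open>hessian\<close> records second derivatives along axes only; linearity of
  \<open>D_on\<close> in its direction, used for w and then for v, reduces to those. The outer
  direction v pairs with the rows, the inner direction w with the columns.\<close>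

lemma D_on_has_derivative_hessian:
  fixes f :: "real^'n \<Rightarrow> real"
  assumes S: "convex S" "interior S \<noteq> {}" and f: "Ck_on k S f" "k \<ge> 2" and x: "x \<in> S"
  shows "((\<lambda>y. D_on S f y w) has_derivative (\<lambda>v. v \<bullet> (hessian S f x *v w))) (at x within S)"
proof -
  let ?T = "\<lambda>v j. D_on S (\<lambda>y. D_on S f y (axis j 1)) x v"
  have expand: "L v = (\<Sum>j\<in>UNIV. v $ j * L (axis j 1))" if "linear L" for L :: "real^'n \<Rightarrow> real" and v
  proof -
    have "L v = L (\<Sum>j\<in>UNIV. (v $ j) *s axis j 1)" by (simp add: basis_expansion)
    also have "\<dots> = (\<Sum>j\<in>UNIV. v $ j * L (axis j 1))"
      using that by (simp add: linear_sum scalar_mult_eq_scaleR linear_scale)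
    finally show ?thesis .
  qed
  have lift: "((\<lambda>y. \<Sum>j\<in>UNIV. w $ j * D_on S f y (axis j 1)) has_derivative (\<lambda>v. \<Sum>j\<in>UNIV. w $ j * ?T v j)) (at x within S)"
    by (intro derivative_intros differentiable_onD_has_derivative Ck_on_2D[OF f] x)
  have "D_on S f y w = (\<Sum>j\<in>UNIV. w $ j * D_on S f y (axis j 1))" if "y \<in> S" for y
    using that Ck_on_2D(1)[OF f] by (intro expand linear_frechet_derivative) (auto simp: differentiable_on_def)
  with lift have "((\<lambda>y. D_on S f y w) has_derivative (\<lambda>v. \<Sum>j\<in>UNIV. w $ j * ?T v j)) (at x within S)"
    by (rule has_derivative_transform[OF x, rotated])
  moreover have "(\<Sum>j\<in>UNIV. w $ j * ?T v j) = v \<bullet> (hessian S f x *v w)" for v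
  proof -
    have "w $ j * ?T v j = w $ j * (\<Sum>i\<in>UNIV. v $ i * ?T (axis i 1) j)" for j
      using x Ck_on_2D(2)[OF f, of "axis j 1"]
      by (intro arg_cong[of _ _ "(*) (w $ j)"] expand linear_frechet_derivative)
        (auto simp: differentiable_on_def)
    then have "w $ j * ?T v j = (\<Sum>i\<in>UNIV. v $ i * (?T (axis i 1) j * w $ j))" for j
      by (simp only: sum_distrib_left mult_ac)
    then have "(\<Sum>j\<in>UNIV. w $ j * ?T v j) = (\<Sum>j\<in>UNIV. \<Sum>i\<in>UNIV. v $ i * (?T (axis i 1) j * w $ j))"
      by (rule sum.cong[OF refl])
    also have "\<dots> = (\<Sum>i\<in>UNIV. \<Sum>j\<in>UNIV. v $ i * (?T (axis i 1) j * w $ j))"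
      by (rule sum.swap)
    also have "\<dots> = v \<bullet> (hessian S f x *v w)"
      by (simp add: inner_vec_def hessian_def matrix_vector_mult_def sum_distrib_left)
    finally show ?thesis .
  qed
  ultimately show ?thesis by simp
qed

lemma iterated_D_hessian:
  fixes f :: "real^'n \<Rightarrow> real"
  assumes "convex S" "interior S \<noteq> {}" "Ck_on k S f" "k \<ge> 2" "x \<in> S"
  shows "iterated_D S f [v, w] x = v \<bullet> (hessian S f x *v w)"
  using D_on_eq[OF assms(1,2,5) D_on_has_derivative_hessian[OF assms]] by simp

text \<open>Tested on u / |u|; it turns bounds on the bilinear form of a Hessian into operator
  bounds.\<close>

lemma norm_le_of_inner_le:
  fixes u :: "'a::real_inner"
  assumes "\<And>v. norm v \<le> 1 \<Longrightarrow> v \<bullet> u \<le> C"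
  shows "norm u \<le> C"
proof (cases "u = 0")
  case True
  then show ?thesis using assms[of 0] by simp
next
  case False
  then have "(u /\<^sub>R norm u) \<bullet> u = norm u"
    by (simp add: power2_norm_eq_inner[symmetric] power2_eq_square)
  then show ?thesis using assms[of "u /\<^sub>R norm u"] False by simp
qed

lemma hessian_bound:
  fixes f :: "real^'n \<Rightarrow> real"
  assumes S: "convex S" "interior S \<noteq> {}" and f: "Ck_on k S f" "k \<ge> 2" and x: "x \<in> S"
    and C: "Ck_norm k S f \<le> ereal C"
  shows "norm (hessian S f x *v w) \<le> C * norm w"
proof -
  have unit: "norm (hessian S f x *v w) \<le> C" if "norm w \<le> 1" for w
  proof (rule norm_le_of_inner_le)
    fix v :: "real^'n" assume "norm v \<le> 1"
    then show "v \<bullet> (hessian S f x *v w) \<le> C"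
      using Ck_normD[OF C x, of "[v, w]"] that f(2) unfolding iterated_D_hessian[OF S f x] by auto
  qed
  then show ?thesis by (rule linear_unit_bound[OF matrix_vector_mul_linear])
qed

text \<open>For fixed unit vectors v, w the scalar function D^2 f(v, w) has derivative of norm at
  most K, so the mean value inequality on the convex S applies. Varying v and w gives the operator
  norm.\<close>

lemma hessian_lipschitz_on_of_Ck_norm:
  fixes f :: "real^'n \<Rightarrow> real"
  assumes S: "convex S" "interior S \<noteq> {}" and f: "Ck_on k S f" "k \<ge> 3"
    and K: "Ck_norm k S f \<le> ereal K"
  shows "hessian_lipschitz_on K S f"
  unfolding hessian_lipschitz_on_def
proof (intro ballI)
  fix x y assume x: "x \<in> S" and y: "y \<in> S"
  have f2: "k \<ge> 2" using f(2) by simp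
  have unit: "norm ((hessian S f x - hessian S f y) *v w) \<le> K * dist x y" if w: "norm w \<le> 1" for w
  proof (rule norm_le_of_inner_le)
    fix v :: "real^'n" assume v: "norm v \<le> 1"
    let ?F = "iterated_D S f [v, w]"
    have "norm (?F x - ?F y) \<le> K * norm (x - y)"
    proof (rule differentiable_bound[OF S(1) _ _ x y])
      fix z assume z: "z \<in> S"
      show deriv: "(?F has_derivative D_on S ?F z) (at z within S)"
        by (rule differentiable_onD_has_derivative[OF Ck_on_3D[OF f] z])
      have "norm (D_on S ?F z u) \<le> K * norm u" for u
      proof (rule linear_unit_bound)
        show "linear (D_on S ?F z)" using deriv by (rule has_derivative_linear)
        show "norm (D_on S ?F z u) \<le> K" if "norm u \<le> 1" for u
          using Ck_normD[OF K z, of "[u, v, w]"] f(2) that v w by simp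
      qed
      then show "onorm (D_on S ?F z) \<le> K" by (rule onorm_le)
    qed
    then show "v \<bullet> ((hessian S f x - hessian S f y) *v w) \<le> K * dist x y"
      unfolding iterated_D_hessian[OF S f(1) f2 x] iterated_D_hessian[OF S f(1) f2 y]
      by (simp add: dist_norm inner_diff_right[symmetric] matrix_vector_mult_diff_rdistrib)
  qed
  show "onorm ((*v) (hessian S f x - hessian S f y)) \<le> K * dist x y"
    by (intro onorm_le linear_unit_bound[OF matrix_vector_mul_linear] unit)
qed

section \<open>Differences of C^k functions\<close>

lemma D_on_diff:
  assumes "convex S" "interior S \<noteq> {}" "x \<in> S" "f differentiable_on S" "g differentiable_on S"
  shows "D_on S (\<lambda>y. g y - f y) x v = D_on S g x v - D_on S f x v"
  using D_on_eq[OF assms(1-3) has_derivative_diff[OF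
    differentiable_onD_has_derivative[OF assms(5,3)] differentiable_onD_has_derivative[OF assms(4,3)]]]
  by simp

text \<open>Serves the induction in \<open>Ck_on_diff\<close>: the formula for the derivative of g -
  f holds on S only, while \<open>Ck_on\<close> takes total functions.\<close>

lemma Ck_on_cong:
  assumes "\<And>x. x \<in> S \<Longrightarrow> f x = g x" "Ck_on k S f"
  shows "Ck_on k S g"
  using assms
proof (induction k arbitrary: f g)
  case 0
  then show ?case by (simp cong: continuous_on_cong)
next
  case (Suc k)
  have eq: "(f has_derivative L) (at x within S) \<longleftrightarrow> (g has_derivative L) (at x within S)" if "x \<in> S" for x L
    using Suc.prems(1) that by (intro iffI; elim has_derivative_transform[rotated 2]) auto
  \<comment> \<open>The same maps qualify as derivatives of f and of g, so the choice operator in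
    \<open>frechet_derivative\<close> picks the same one.\<close>
  then have "D_on S f x = D_on S g x" if "x \<in> S" for x
    using that by (simp add: frechet_derivative_def)
  moreover have "g differentiable_on S"
    using Suc.prems(2) eq by (auto simp: differentiable_on_def differentiable_def)
  ultimately show ?case
    using Suc.prems(2) Suc.IH by (metis (no_types, lifting) Ck_on.simps(2))
qed

lemma Ck_on_diff:
  assumes S: "convex S" "interior S \<noteq> {}" and "Ck_on k S f" "Ck_on k S g"
  shows "Ck_on k S (\<lambda>y. g y - f y)"
  using assms(3,4)
proof (induction k arbitrary: f g)
  case 0
  then show ?case by (simp add: continuous_on_diff)
next
  case (Suc k)
  have "Ck_on k S (\<lambda>x. D_on S (\<lambda>y. g y - f y) x v)" for v
  proof (rule Ck_on_cong)
    show "Ck_on k S (\<lambda>x. D_on S g x v - D_on S f x v)"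
      using Suc by simp
    show "D_on S g x v - D_on S f x v = D_on S (\<lambda>y. g y - f y) x v" if "x \<in> S" for x
      using D_on_diff[OF S that] Suc.prems by simp
  qed
  then show ?case using Suc.prems by (simp add: differentiable_on_diff)
qed

text \<open>Both sides describe the derivative of
  \<open>\<lambda>y. D_on S (\<lambda>y. g y - f y) y w\<close> within S, which is unique.\<close>

lemma hessian_diff:
  fixes f g :: "real^'n \<Rightarrow> real"
  assumes S: "convex S" "interior S \<noteq> {}" "x \<in> S" and k: "k \<ge> 2"
    and fg: "Ck_on k S f" "Ck_on k S g"
  shows "hessian S (\<lambda>y. g y - f y) x *v w = hessian S g x *v w - hessian S f x *v w"
proof -
  let ?h = "\<lambda>y. g y - f y"
  have "((\<lambda>y. D_on S g y w - D_on S f y w) has_derivative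
      (\<lambda>v. v \<bullet> (hessian S g x *v w) - v \<bullet> (hessian S f x *v w))) (at x within S)"
    by (intro has_derivative_diff D_on_has_derivative_hessian[OF S(1,2) _ k S(3)] fg)
  then have "((\<lambda>y. D_on S ?h y w) has_derivative
      (\<lambda>v. v \<bullet> (hessian S g x *v w) - v \<bullet> (hessian S f x *v w))) (at x within S)"
    using S k fg by (elim has_derivative_transform[rotated 2]) (auto intro!: D_on_diff Ck_on_2D)
  from has_derivative_within_convex_unique[OF S this
      D_on_has_derivative_hessian[OF S(1,2) Ck_on_diff[OF S(1,2) fg] k S(3)]]
  have "\<forall>v. v \<bullet> (hessian S g x *v w - hessian S f x *v w) = v \<bullet> (hessian S ?h x *v w)"
    by (simp add: fun_eq_iff inner_diff_right)
  then show ?thesis by (simp add: vector_eq_ldot)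
qed

section \<open>The smallest singular value as a lower bound\<close>

lemma sigma_min_le:
  fixes L :: "real^'n^'n"
  shows "sigma_min L * norm w \<le> norm (L *v w)"
proof (cases "w = 0")
  case False
  have "sigma_min L \<le> norm (L *v (w /\<^sub>R norm w))"
    unfolding sigma_min_def using False
    by (intro cINF_lower bdd_belowI2[of _ 0]) auto
  then show ?thesis using False
    by (simp add: matrix_vector_mult_scaleR divide_simps)
qed simp

lemma sigma_min_ge:
  fixes L :: "real^'n^'n"
  assumes "\<And>w. c * norm w \<le> norm (L *v w)"
  shows "c \<le> sigma_min L"
proof -
  have "axis undefined 1 \<in> sphere (0::real^'n) 1" by simp
  then have "sphere (0::real^'n) 1 \<noteq> {}" by blast
  then show ?thesis unfolding sigma_min_def
    by (rule cINF_greatest) (metis assms mem_sphere_0 mult.right_neutral)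
qed

section \<open>First- and second-order estimates for the perturbed function\<close>

text \<open>The reals \<open>c\<close>, \<open>r\<close>, \<open>m\<close>, \<open>e\<close> stand for \<open>\<gamma>\<close>, \<open>\<rho>\<close>, \<open>\<eta>\<close> and the distance between \<open>f\<close> and \<open>g\<close>.\<close>

locale morse_perturbation =
  fixes f g :: "real^'n \<Rightarrow> real" and k :: nat and K c r m e :: real and B :: "(real^'n) set"
  assumes B: "B = cball 0 1"
    and k: "k \<ge> 2"
    and f_Ck: "Ck_on k B f"
    and g_Ck: "Ck_on k B g"
    and K_pos: "K > 0"
    and f_K: "Ck_norm k B f \<le> ereal K"
    and f_Lip: "hessian_lipschitz_on K B f"
    and h_e: "Ck_norm k B (\<lambda>y. g y - f y) \<le> ereal e"
    and c_pos: "c > 0"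
    and sigma: "s \<in> critical_points B f \<Longrightarrow> c \<le> sigma_min (hessian B f s)"
    and r_pos: "r > 0"
    and r_c: "128 * K\<^sup>2 * r \<le> c\<^sup>2"
    and r_gap: "s \<in> critical_points B f \<Longrightarrow> t \<in> critical_points B f \<Longrightarrow> s \<noteq> t \<Longrightarrow> 8 * K * r \<le> \<bar>f s - f t\<bar>"
    and r_boundary: "s \<in> critical_points B f \<Longrightarrow> norm s + r \<le> 1"
    and e_m: "e < m / 2"
    and e_c: "64 * K * e \<le> c\<^sup>2"
    and Df_ge: "y \<in> B \<Longrightarrow> (\<And>s. s \<in> critical_points B f \<Longrightarrow> r \<le> dist y s) \<Longrightarrow> m \<le> onorm (D_on B f y)"
begin

lemma convex_B: "convex B" and interior_B: "interior B \<noteq> {}"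
  by (simp_all add: B)

lemmas f_D = Ck_on_2D[OF f_Ck k] and g_D = Ck_on_2D[OF g_Ck k]

lemma D_on_bounded_linear:
  assumes "y \<in> B"
  shows "bounded_linear (D_on B f y)" "bounded_linear (D_on B g y)"
  using differentiable_onD_has_derivative[OF f_D(1) assms] differentiable_onD_has_derivative[OF g_D(1) assms]
  by (auto dest: has_derivative_bounded_linear)

lemma Df_bound: "y \<in> B \<Longrightarrow> \<bar>D_on B f y v\<bar> \<le> K * norm v"
  by (rule D_on_bound[OF f_D(1) f_K]) (use k in auto)

lemma Dg_minus_Df_bound:
  assumes "y \<in> B"
  shows "\<bar>D_on B g y v - D_on B f y v\<bar> \<le> e * norm v"
proof -
  have "\<bar>D_on B (\<lambda>y. g y - f y) y v\<bar> \<le> e * norm v"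
    using k assms by (intro D_on_bound[OF differentiable_on_diff[OF g_D(1) f_D(1)] h_e]) auto
  then show ?thesis by (simp add: D_on_diff[OF convex_B interior_B assms f_D(1) g_D(1)])
qed

lemma f_lipschitz:
  assumes "a \<in> B" "b \<in> B"
  shows "\<bar>f a - f b\<bar> \<le> K * dist a b"
proof -
  have "norm (f a - f b) \<le> K * norm (a - b)"
    using Df_bound
    by (intro differentiable_bound[OF convex_B differentiable_onD_has_derivative[OF f_D(1)] _ assms] onorm_le)
      auto
  then show ?thesis by (simp add: dist_norm)
qed

text \<open>\<open>Ck_norm\<close> leaves out the values, so g and f may differ by a large constant.
  Only the variation of g - f is controlled, which suffices for gaps between critical
  values.\<close>

lemma g_minus_f_lipschitz:
  assumes "a \<in> B" "b \<in> B"
  shows "\<bar>(g a - f a) - (g b - f b)\<bar> \<le> e * dist a b"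
proof -
  have "norm ((g a - f a) - (g b - f b)) \<le> e * norm (a - b)"
  proof (rule differentiable_bound[OF convex_B _ _ assms])
    fix y assume y: "y \<in> B"
    show "((\<lambda>y. g y - f y) has_derivative (\<lambda>v. D_on B g y v - D_on B f y v)) (at y within B)"
      by (intro has_derivative_diff differentiable_onD_has_derivative f_D g_D y)
    show "onorm (\<lambda>v. D_on B g y v - D_on B f y v) \<le> e"
      using Dg_minus_Df_bound[OF y] by (intro onorm_le) simp
  qed
  then show ?thesis by (simp add: dist_norm)
qed

lemma critical_points_in_B:
  "s \<in> critical_points B f \<Longrightarrow> s \<in> B" "z \<in> critical_points B g \<Longrightarrow> z \<in> B"
  by (simp_all add: critical_points_def)

text \<open>At distance at least r from all critical points of f, |Df| is at least m, whereas |Df|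
  <= |Dg| + e < m/2 + m/2.\<close>

lemma near_critical_point:
  assumes y: "y \<in> B" and small: "onorm (D_on B g y) < m / 2"
  shows "\<exists>s\<in>critical_points B f. dist y s < r"
proof (rule ccontr)
  assume "\<not> ?thesis"
  then have "m \<le> onorm (D_on B f y)" using Df_ge[OF y] by (meson not_le)
  also have "\<dots> \<le> onorm (D_on B g y) + e"
  proof (rule onorm_le)
    fix v
    have "\<bar>D_on B g y v\<bar> \<le> onorm (D_on B g y) * norm v"
      using onorm[OF D_on_bounded_linear(2)[OF y], of v] by simp
    with Dg_minus_Df_bound[OF y, of v]
    show "norm (D_on B f y v) \<le> (onorm (D_on B g y) + e) * norm v"
      by (simp add: algebra_simps abs_le_iff)
  qed
  finally show False using small e_m by simp
qed

lemma near_of_critical_point: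
  assumes "z \<in> critical_points B g" "0 < m"
  shows "\<exists>s\<in>critical_points B f. dist z s < r"
proof (rule near_critical_point)
  show "onorm (D_on B g z) < m / 2"
    using assms by (simp add: critical_points_def onorm_zero)
qed (rule critical_points_in_B(2)[OF assms(1)])

lemma cball_in_B: "s \<in> critical_points B f \<Longrightarrow> cball s r \<subseteq> B"
  using r_boundary[of s] by (auto simp: B cball_subset_cball_iff dist_norm)

lemma near_in_ball: "s \<in> critical_points B f \<Longrightarrow> dist y s < r \<Longrightarrow> y \<in> ball 0 1"
  using r_boundary[of s] dist_triangle[of y 0 s] by (simp add: dist_norm norm_minus_commute)

lemma hessian_f_ge:
  assumes "s \<in> critical_points B f"
  shows "c * norm w \<le> norm (hessian B f s *v w)"
  using sigma[OF assms] sigma_min_le[of "hessian B f s" w]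
  by (meson mult_right_mono norm_ge_zero order_trans)

text \<open>Compare both with Hf(y): Hg(y) - Hf(y) costs e <= c/64, and Hf(y) - Hf(s) costs K r <=
  c/128 by the Lipschitz condition. The sum is well below c/4.\<close>

lemma hessian_g_near:
  assumes s: "s \<in> critical_points B f" and y: "dist y s \<le> r"
  shows "norm (hessian B g y *v w - hessian B f s *v w) \<le> c / 4 * norm w"
proof -
  have sB: "s \<in> B" and yB: "y \<in> B"
    using cball_in_B[OF s] r_pos y by (auto simp: dist_commute)
  let ?w = "axis undefined 1 :: real^'n"
  \<comment> \<open>On a unit vector Hf(s) expands by at least c and at most K. This turns the
    quadratic bounds \<open>e_c\<close> and \<open>r_c\<close> into bounds linear in c.\<close>
  have "c \<le> K"
    using order_trans[OF hessian_f_ge[OF s, of ?w] hessian_bound[OF convex_B interior_B f_Ck k sB f_K]] by simp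
  then have cK: "c\<^sup>2 \<le> c * K" using c_pos by (simp add: power2_eq_square)
  have "K * (64 * e) \<le> K * c" using e_c cK by (simp add: algebra_simps)
  then have e: "e \<le> c / 64" using K_pos by simp
  have "K * (128 * (K * r)) \<le> K * c" using r_c cK by (simp add: algebra_simps power2_eq_square)
  then have Kr: "K * r \<le> c / 128" using K_pos by simp
  have "norm (hessian B g y *v w - hessian B f y *v w) \<le> e * norm w"
    using hessian_bound[OF convex_B interior_B Ck_on_diff[OF convex_B interior_B f_Ck g_Ck] k yB h_e, of w]
    by (simp add: hessian_diff[OF convex_B interior_B yB k f_Ck g_Ck])
  also have "\<dots> \<le> c / 64 * norm w" using e by (intro mult_right_mono) auto
  finally have 1: "norm (hessian B g y *v w - hessian B f y *v w) \<le> c / 64 * norm w" .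
  have "norm ((hessian B f y - hessian B f s) *v w)
      \<le> onorm ((*v) (hessian B f y - hessian B f s)) * norm w"
    by (rule onorm) (rule matrix_vector_mul_bounded_linear)
  also have "\<dots> \<le> (K * dist y s) * norm w"
    using f_Lip yB sB by (intro mult_right_mono) (auto simp: hessian_lipschitz_on_def)
  also have "\<dots> \<le> (K * r) * norm w"
    using y K_pos by (intro mult_right_mono mult_left_mono) auto
  also have "\<dots> \<le> c / 128 * norm w" using Kr by (intro mult_right_mono) auto
  finally have 2: "norm (hessian B f y *v w - hessian B f s *v w) \<le> c / 128 * norm w"
    by (simp add: matrix_vector_mult_diff_rdistrib)
  have "norm (hessian B g y *v w - hessian B f s *v w) \<le> c / 64 * norm w + c / 128 * norm w"
    by (rule norm_diff_triangle_le[OF 1 2])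
  also have "\<dots> \<le> c / 4 * norm w"
    using mult_nonneg_nonneg[of c "norm w"] c_pos by simp
  finally show ?thesis .
qed

text \<open>Of the lower bound c for Hf(s), at most c/4 is lost in passing to Hg(y).\<close>

lemma hessian_g_ge:
  assumes s: "s \<in> critical_points B f" and y: "dist y s \<le> r"
  shows "c / 2 * norm w \<le> norm (hessian B g y *v w)"
proof -
  have "c * norm w \<le> norm (hessian B g y *v w) + c / 4 * norm w"
    using hessian_f_ge[OF s, of w] hessian_g_near[OF s y, of w]
      norm_triangle_ineq2[of "hessian B f s *v w" "hessian B g y *v w"]
    by (simp add: norm_minus_commute)
  moreover have "0 \<le> c * norm w" using c_pos by simp
  ultimately show ?thesis by simp
qed

lemma sigma_min_hessian_g_ge:
  assumes "s \<in> critical_points B f" "dist y s \<le> r"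
  shows "c / 2 \<le> sigma_min (hessian B g y)"
  by (rule sigma_min_ge) (rule hessian_g_ge[OF assms])

section \<open>Matching the critical points of f and g\<close>

text \<open>f has Lipschitz constant K and its critical values at s and t differ by at least 8 K r.
  So a point within r of s is far from every other critical point of f.\<close>

lemma critical_points_separated:
  assumes "s \<in> critical_points B f" "t \<in> critical_points B f" "s \<noteq> t"
  shows "8 * r \<le> dist s t"
proof -
  have "K * (8 * r) \<le> K * dist s t"
    using r_gap[OF assms] f_lipschitz[of s t] assms(1,2) critical_points_in_B by fastforce
  then show ?thesis using K_pos by simp
qed

text \<open>The scalar function \<open>\<xi> \<mapsto> Dg(\<xi>) w - (y - z) \<bullet> \<xi>\<close> with \<open>Hf(s) w = y - z\<close> has a small
  derivative near \<open>s\<close>, but its values at \<open>y\<close> and \<open>z\<close> differ by \<open>|y - z|\<^sup>2\<close>.\<close>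

lemma critical_point_g_unique:
  assumes s: "s \<in> critical_points B f"
    and y: "y \<in> critical_points B g" "dist y s \<le> r"
    and z: "z \<in> critical_points B g" "dist z s \<le> r"
  shows "y = z"
proof (rule ccontr)
  assume "y \<noteq> z"
  let ?A = "hessian B f s"
  have "v = 0" if "?A *v v = 0" for v
    using hessian_f_ge[OF s, of v] c_pos that by (simp add: mult_le_0_iff)
  then have "inj ((*v) ?A)"
    using linear_injective_0[OF matrix_vector_mul_linear[of ?A]] by blast
  then have "surj ((*v) ?A)"
    by (rule linear_inj_imp_surj[OF matrix_vector_mul_linear])
  then obtain w where w: "?A *v w = y - z" by (metis surjD)
  let ?F = "\<lambda>\<xi>. D_on B g \<xi> w - \<xi> \<bullet> (y - z)"
  have "norm (?F y - ?F z) \<le> c / 4 * norm w * norm (y - z)"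
  proof (rule differentiable_bound)
    show "convex (cball s r)" by simp
    show "y \<in> cball s r" "z \<in> cball s r" using y z by (auto simp: dist_commute)
    fix \<xi> assume \<xi>: "\<xi> \<in> cball s r"
    then have "\<xi> \<in> B" using cball_in_B[OF s] by blast
    then have "((\<lambda>y. D_on B g y w) has_derivative (\<lambda>v. v \<bullet> (hessian B g \<xi> *v w))) (at \<xi> within cball s r)"
      using D_on_has_derivative_hessian[OF convex_B interior_B g_Ck k] cball_in_B[OF s]
      by (blast intro: has_derivative_subset)
    then show "(?F has_derivative (\<lambda>v. v \<bullet> (hessian B g \<xi> *v w) - v \<bullet> (y - z))) (at \<xi> within cball s r)"
      by (intro has_derivative_diff has_derivative_inner_left has_derivative_ident)
    show "onorm (\<lambda>v. v \<bullet> (hessian B g \<xi> *v w) - v \<bullet> (y - z)) \<le> c / 4 * norm w"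
    proof (rule onorm_le)
      fix v
      have "norm (v \<bullet> (hessian B g \<xi> *v w) - v \<bullet> (y - z)) \<le> norm v * norm (hessian B g \<xi> *v w - ?A *v w)"
        by (simp add: w inner_diff_right[symmetric] Cauchy_Schwarz_ineq2)
      also have "\<dots> \<le> norm v * (c / 4 * norm w)"
        using hessian_g_near[OF s] \<xi> by (intro mult_left_mono) (auto simp: dist_commute)
      finally show "norm (v \<bullet> (hessian B g \<xi> *v w) - v \<bullet> (y - z)) \<le> c / 4 * norm w * norm v"
        by (simp add: mult_ac)
    qed
  qed
  moreover have "?F y - ?F z = - ((norm (y - z))\<^sup>2)"
    using y(1) z(1) by (simp add: critical_points_def power2_norm_eq_inner inner_diff_left)
  \<comment> \<open>From Hf(s) w = y - z follows c |w| <= |y - z|, so the mean value bound is a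
    quarter of |y - z|^2.\<close>
  moreover have "c / 4 * norm w * norm (y - z) \<le> norm (y - z) / 4 * norm (y - z)"
    using hessian_f_ge[OF s, of w] by (intro mult_right_mono) (auto simp: w)
  ultimately have "norm (y - z) * norm (y - z) \<le> norm (y - z) * norm (y - z) / 4"
    by (simp add: power2_eq_square)
  moreover have "0 < norm (y - z) * norm (y - z)" using \<open>y \<noteq> z\<close> by simp
  ultimately show False by linarith
qed

text \<open>A vector in place of the functional \<open>D_on B g y\<close>: its squared Euclidean
  norm can be differentiated and minimised.\<close>

definition gradient_g :: "real^'n \<Rightarrow> real^'n" where
  "gradient_g y = (\<chi> j. D_on B g y (axis j 1))"

lemma gradient_g_inner:
  assumes "y \<in> B"
  shows "D_on B g y v = gradient_g y \<bullet> v"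
proof -
  have lin: "linear (D_on B g y)"
    using D_on_bounded_linear(2)[OF assms] by (rule bounded_linear.linear)
  have "D_on B g y v = D_on B g y (\<Sum>j\<in>UNIV. (v $ j) *s axis j 1)"
    by (simp add: basis_expansion)
  then show ?thesis using lin
    by (simp add: linear_sum scalar_mult_eq_scaleR linear_scale inner_vec_def gradient_g_def mult.commute)
qed

text \<open>The direction of differentiation belongs to the rows of \<open>hessian\<close>, so v
  multiplies from the left.\<close>

lemma gradient_g_has_derivative:
  assumes "y \<in> B"
  shows "(gradient_g has_derivative (\<lambda>v. v v* hessian B g y)) (at y within B)"
proof (subst has_derivative_componentwise_within, rule ballI)
  fix i :: "real^'n" assume "i \<in> Basis"
  then obtain j where i: "i = axis j 1"
    by (auto simp: Basis_vec_def)
  have eq: "gradient_g y \<bullet> i = D_on B g y i" for y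
    by (simp add: i inner_axis gradient_g_def)
  show "((\<lambda>y. gradient_g y \<bullet> i) has_derivative (\<lambda>v. (v v* hessian B g y) \<bullet> i)) (at y within B)"
    unfolding eq dot_lmul_matrix
    by (rule D_on_has_derivative_hessian[OF convex_B interior_B g_Ck k assms])
qed

text \<open>The gradient of \<open>g\<close> is smaller at \<open>s\<close> than on the sphere around \<open>s\<close>, so \<open>|\<nabla>g|\<^sup>2\<close> has an
  interior minimum. Its derivative \<open>2 Hg \<nabla>g\<close> vanishes there, and \<open>Hg\<close> is injective.\<close>

lemma critical_point_g_exists:
  assumes s: "s \<in> critical_points B f"
  shows "\<exists>z\<in>critical_points B g. dist z s < r"
proof -
  let ?G = gradient_g
  have sub: "cball s r \<subseteq> B" by (rule cball_in_B[OF s])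
  have "continuous_on (cball s r) ?G"
    using gradient_g_has_derivative sub
    by (meson continuous_on_subset has_derivative_continuous_on)
  then have "continuous_on (cball s r) (\<lambda>y. norm (?G y))" by (intro continuous_intros)
  then obtain z where z: "z \<in> cball s r" and min: "\<And>y. y \<in> cball s r \<Longrightarrow> norm (?G z) \<le> norm (?G y)"
    using continuous_attains_inf[of "cball s r" "\<lambda>y. norm (?G y)"] r_pos by auto
  then have zB: "z \<in> B" using sub by blast
  \<comment> \<open>Df(s) = 0, so Dg(s) equals the derivative of g - f at s.\<close>
  have "norm (?G s) \<le> e"
  proof (rule norm_le_of_inner_le)
    fix v :: "real^'n" assume v: "norm v \<le> 1"
    have "\<bar>v \<bullet> ?G s\<bar> \<le> e * norm v"
      using Dg_minus_Df_bound[of s v] gradient_g_inner[of s v] s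
      by (simp add: critical_points_def inner_commute)
    moreover have "e * norm v \<le> e"
    proof -
      have "0 \<le> e" using Dg_minus_Df_bound[of s "axis undefined 1"] critical_points_in_B(1)[OF s]
        by (simp add: order_trans[OF abs_ge_zero])
      then show ?thesis using v by (simp add: mult_left_le)
    qed
    ultimately show "v \<bullet> ?G s \<le> e" by simp
  qed
  then have "norm (?G z) < m / 2" using min[of s] r_pos e_m by simp
  moreover have "onorm (D_on B g z) \<le> norm (?G z)"
    by (rule onorm_le) (simp add: gradient_g_inner[OF zB] Cauchy_Schwarz_ineq2)
  ultimately have "onorm (D_on B g z) < m / 2" by simp
  \<comment> \<open>The minimiser z is only known to lie in the closed ball. As |Dg(z)| < m/2, it
    lies strictly within r of some critical point t, and separation forces t = s; hence z is an
    interior point.\<close>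
  from near_critical_point[OF zB this] obtain t where t: "t \<in> critical_points B f" "dist z t < r" by blast
  have "t = s"
  proof (rule ccontr)
    assume "t \<noteq> s"
    then have "8 * r \<le> dist s t" using critical_points_separated[OF s t(1)] by blast
    then show False using t(2) z r_pos dist_triangle[of s t z] by (simp add: dist_commute)
  qed
  with t have zr: "dist z s < r" by simp
  have "ball s r \<subseteq> interior B" using sub ball_subset_cball by (intro interior_maximal) auto
  then have "at z within B = at z"
    using zr by (intro at_within_interior) (auto simp: dist_commute)
  then have der: "(?G has_derivative (\<lambda>v. v v* hessian B g z)) (at z)"
    using gradient_g_has_derivative[OF zB] by simp
  have "((\<lambda>y. ?G y \<bullet> ?G y) has_derivative
      (\<lambda>v. ?G z \<bullet> (v v* hessian B g z) + (v v* hessian B g z) \<bullet> ?G z)) (at z)"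
    by (rule has_derivative_inner[OF der der])
  moreover have "\<forall>y\<in>ball s r. ?G z \<bullet> ?G z \<le> ?G y \<bullet> ?G y"
    using min by (simp add: norm_le[symmetric])
  ultimately have "(\<lambda>v. ?G z \<bullet> (v v* hessian B g z) + (v v* hessian B g z) \<bullet> ?G z) = (\<lambda>v. 0)"
    using zr by (intro differential_zero_maxmin[of z "ball s r"]) (auto simp: dist_commute)
  then have "\<forall>v. v \<bullet> (hessian B g z *v ?G z) = 0"
    by (simp add: fun_eq_iff inner_commute[of "?G z"] dot_lmul_matrix)
  then have "hessian B g z *v ?G z = 0" by (metis inner_eq_zero_iff)
  then have "c / 2 * norm (?G z) \<le> 0" using hessian_g_ge[OF s, of z "?G z"] zr by simp
  then have "?G z = 0" using c_pos by (simp add: mult_le_0_iff)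
  then have "z \<in> critical_points B g"
    using zB gradient_g_inner[OF zB] by (simp add: critical_points_def fun_eq_iff)
  with zr show ?thesis by blast
qed

section \<open>Gaps between critical values\<close>

text \<open>A point y at distance exactly r from s is at least r away from every critical point, so
  |Df(y)| >= m. On the other hand Df(s) = 0 and the Hessian is bounded by K, so |Df(y)| <= K
  r.\<close>

lemma m_le:
  assumes s: "s \<in> critical_points B f"
  shows "m \<le> K * r"
proof -
  define y where "y = s + r *\<^sub>R axis undefined 1"
  have ys: "dist y s = r" using r_pos by (simp add: y_def dist_norm)
  then have y: "y \<in> B" using cball_in_B[OF s] by (auto simp: dist_commute)
  have sB: "s \<in> B" by (rule critical_points_in_B(1)[OF s])
  have "r \<le> dist y t" if t: "t \<in> critical_points B f" for t
  proof (cases "t = s")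
    case False
    then have "8 * r \<le> dist s t" using critical_points_separated[OF s t] by blast
    then show ?thesis using ys r_pos dist_triangle[of s t y] by (simp add: dist_commute)
  qed (simp add: ys)
  then have "m \<le> onorm (D_on B f y)" by (rule Df_ge[OF y])
  also have "\<dots> \<le> K * r"
  proof (rule onorm_le)
    fix v
    have "norm (D_on B f y v - D_on B f s v) \<le> (K * norm v) * norm (y - s)"
    proof (rule differentiable_bound[OF convex_B _ _ y sB])
      fix \<xi> assume \<xi>: "\<xi> \<in> B"
      show "((\<lambda>y. D_on B f y v) has_derivative (\<lambda>u. u \<bullet> (hessian B f \<xi> *v v))) (at \<xi> within B)"
        by (rule D_on_has_derivative_hessian[OF convex_B interior_B f_Ck k \<xi>])
      show "onorm (\<lambda>u. u \<bullet> (hessian B f \<xi> *v v)) \<le> K * norm v"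
      proof (rule onorm_le)
        fix u
        have "norm (u \<bullet> (hessian B f \<xi> *v v)) \<le> norm u * norm (hessian B f \<xi> *v v)"
          by (simp add: Cauchy_Schwarz_ineq2)
        also have "\<dots> \<le> norm u * (K * norm v)"
          by (intro mult_left_mono hessian_bound[OF convex_B interior_B f_Ck k \<xi> f_K]) simp
        finally show "norm (u \<bullet> (hessian B f \<xi> *v v)) \<le> K * norm v * norm u" by (simp add: mult_ac)
      qed
    qed
    then show "norm (D_on B f y v) \<le> K * r * norm v"
      using s ys by (simp add: critical_points_def dist_norm mult_ac)
  qed
  finally show ?thesis .
qed

text \<open>Moving from s, s' to z, z' changes the gap of f by at most 2 K r. Replacing f by g costs
  at most 2 e <= K r, since B has diameter 2 and e < m/2 <= K r / 2. The total 3 K r is at most 3/8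
  of the original gap.\<close>

lemma critical_value_gap:
  assumes s: "s \<in> critical_points B f" "s' \<in> critical_points B f" "s \<noteq> s'"
    and z: "z \<in> B" "dist z s < r" and z': "z' \<in> B" "dist z' s' < r"
  shows "\<bar>f s - f s'\<bar> / 2 \<le> \<bar>g z - g z'\<bar>"
proof -
  have 1: "\<bar>f a - f b\<bar> \<le> K * r" if "a \<in> B" "b \<in> critical_points B f" "dist a b < r" for a b
    using f_lipschitz[OF that(1) critical_points_in_B(1)[OF that(2)]]
      mult_left_mono[of "dist a b" r K] K_pos that(3) by linarith
  have "dist z z' \<le> 2"
    using z(1) z'(1) dist_triangle2[of z z' 0] by (simp add: B)
  moreover have "e \<le> K * r / 2" using m_le[OF s(1)] e_m by simp
  moreover have Kr: "0 < K * r" using K_pos r_pos by simp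
  ultimately have "e * dist z z' \<le> K * r / 2 * 2"
    by (intro mult_mono) auto
  then have "\<bar>(g z - f z) - (g z' - f z')\<bar> \<le> K * r"
    using g_minus_f_lipschitz[OF z(1) z'(1)] by simp
  moreover note 1[OF z(1) s(1) z(2)] 1[OF z'(1) s(2) z'(2)]
  moreover have "8 * (K * r) \<le> \<bar>f s - f s'\<bar>" using r_gap[OF s] by (simp add: mult_ac)
  ultimately show ?thesis using Kr by argo
qed

end

section \<open>From the extended-real constants to the real ones of the locale\<close>

text \<open>Hf(y) near a critical point s has to be compared with Hf(s). For k = 2 the bound
  \<open>f_K\<close> controls no third derivative, so \<open>f_Lip\<close> supplies the
  estimate.\<close>

theorem theorem4p5:
  fixes f :: "real^'n \<Rightarrow> real" and k p :: nat and K :: real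
    and x :: "nat \<Rightarrow> real^'n" and B :: "(real^'n) set"
    and \<gamma> d \<rho> \<eta> \<epsilon> :: ereal
  assumes B: "B = cball 0 1"
    and k: "k \<ge> 2"
    and f_Ck: "Ck_on k B f"
    and f_K: "Ck_norm k B f \<le> ereal K"
    and f_Lip: "k = 2 \<Longrightarrow> hessian_lipschitz_on K B f"
    and f_morse: "morse_on B f"
    and crit: "critical_points B f = x ` {1..p}" "x ` {1..p} \<subseteq> ball 0 1"
    and distinct_values: "\<And>i j. i \<in> {1..p} \<Longrightarrow> j \<in> {1..p} \<Longrightarrow> i \<noteq> j \<Longrightarrow> f (x i) \<noteq> f (x j)"
    and \<gamma>: "\<gamma> = (INF y\<in>critical_points B f. ereal (sigma_min (hessian B f y)))"
    and d: "d = min_gap f x p"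
    and \<rho>: "\<rho> = min (\<gamma>^2 / ereal (128 * K^2))
                  (min (d / ereal (8 * K)) (dist_sets (critical_points B f) (sphere 0 1)))"
    and \<eta>: "\<eta> = (INF y\<in>{y \<in> B. dist_set y (critical_points B f) \<ge> \<rho>}. ereal (onorm (D_on B f y)))"
    and \<epsilon>: "\<epsilon> = min (\<eta> / 2) (min (\<gamma>^2 / ereal (64 * K)) (d / 4))"
  shows "\<forall>g. Ck_on k B g \<and> Ck_norm k B (\<lambda>y. g y - f y) < \<epsilon> \<longrightarrow>
    (\<forall>y\<in>ball 0 1. ereal (onorm (D_on B g y)) < \<eta> / 2 \<longrightarrow>
        ereal (sigma_min (hessian B g y)) \<ge> \<gamma> / 2) \<and>
    morse_on B g \<and>
    (\<exists>z :: nat \<Rightarrow> real^'n.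
        inj_on z {1..p} \<and>
        critical_points B g = z ` {1..p} \<and> z ` {1..p} \<subseteq> ball 0 1 \<and>
        (\<forall>i\<in>{1..p}. ereal (norm (z i - x i)) < \<rho>) \<and>
        (\<forall>i\<in>{1..p}. ereal (sigma_min (hessian B g (z i))) \<ge> \<gamma> / 2) \<and>
        min_gap g z p \<ge> d / 2)"
proof (intro allI impI, elim conjE)
  fix g assume g_Ck: "Ck_on k B g" and close: "Ck_norm k B (\<lambda>y. g y - f y) < \<epsilon>"
  let ?\<Sigma> = "critical_points B f" and ?h = "\<lambda>y. g y - f y"
  \<comment> \<open>A boundary point of B, hence not critical. Df is nonzero there, which gives K >
    0, and its distance to the critical points is at least \<open>\<rho>\<close>, which makes
    \<open>\<eta>\<close> finite.\<close>
  let ?b = "axis undefined 1 :: real^'n"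
  have S: "convex B" "interior B \<noteq> {}" by (simp_all add: B)
  have f_D: "f differentiable_on B" by (rule Ck_on_2D(1)[OF f_Ck k])
  have \<Sigma>_ball: "?\<Sigma> \<subseteq> ball 0 1" using crit by simp
  then have b: "?b \<in> B" "?b \<notin> ?\<Sigma>" "?b \<in> sphere 0 1"
    by (auto simp: B)
  have K_pos: "K > 0"
  proof -
    obtain v where "D_on B f ?b v \<noteq> 0"
      using b(1,2) by (auto simp: critical_points_def fun_eq_iff)
    moreover have "\<bar>D_on B f ?b v\<bar> \<le> K * norm v"
      using D_on_bound[OF f_D f_K _ b(1)] k by simp
    ultimately have "0 < K * norm v" by linarith
    then show ?thesis by (simp add: zero_less_mult_iff)
  qed
  have f_Lip': "hessian_lipschitz_on K B f"
    using f_Lip hessian_lipschitz_on_of_Ck_norm[OF S f_Ck _ f_K] k by (cases "k = 2") auto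

  obtain e where e: "Ck_norm k B ?h = ereal e" "0 \<le> e"
  proof -
    \<comment> \<open>A real bound on the norm dominates an absolute value, here in the zero
      direction. The case C = -1 then excludes the value minus infinity.\<close>
    have *: "0 \<le> C" if "Ck_norm k B ?h \<le> ereal C" for C
      using Ck_normD[OF that b(1), of "[0]"] k by simp
    from close have "Ck_norm k B ?h \<noteq> \<infinity>" by auto
    moreover from *[of "- 1"] have "Ck_norm k B ?h \<noteq> - \<infinity>" by auto
    ultimately show ?thesis using that * by (cases "Ck_norm k B ?h") auto
  qed
  have e_less: "ereal e < \<eta> / 2" "ereal e < \<gamma>^2 / ereal (64 * K)"
    using close by (simp_all add: e \<epsilon>)

  have "dist_set ?b ?\<Sigma> \<ge> \<rho>"
    unfolding dist_set_def[of ?b]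
  proof (rule INF_greatest)
    fix s assume s: "s \<in> ?\<Sigma>"
    have "\<rho> \<le> dist_sets ?\<Sigma> (sphere 0 1)" by (simp add: \<rho> min.coboundedI2)
    also have "\<dots> \<le> dist_set s (sphere 0 1)" unfolding dist_sets_def by (rule INF_lower[OF s])
    also have "\<dots> \<le> ereal (dist s ?b)" unfolding dist_set_def by (rule INF_lower[OF b(3)])
    finally show "\<rho> \<le> ereal (dist ?b s)" by (simp add: dist_commute)
  qed
  then have \<eta>_le: "\<eta> \<le> ereal (onorm (D_on B f ?b))"
    unfolding \<eta> using b(1) by (intro INF_lower) simp
  have "0 < \<eta>" using e_less(1) e(2) by (cases \<eta>) auto
  with \<eta>_le obtain m where m: "\<eta> = ereal m" "0 < m" by (cases \<eta>) auto
  have e_m: "e < m / 2" using e_less(1) by (simp add: m)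

  txt \<open>If \<open>f\<close> has no critical point, then \<open>\<gamma> = \<rho> = \<infinity>\<close>, and any sufficiently large \<open>c\<close> will do.\<close>
  obtain c r where c: "c > 0" "\<And>s. s \<in> ?\<Sigma> \<Longrightarrow> c \<le> sigma_min (hessian B f s)" "?\<Sigma> \<noteq> {} \<Longrightarrow> \<gamma> = ereal c"
    and r: "r > 0" "?\<Sigma> \<noteq> {} \<Longrightarrow> \<rho> = ereal r" "\<And>y. \<forall>s\<in>?\<Sigma>. r \<le> dist y s \<Longrightarrow> \<rho> \<le> dist_set y ?\<Sigma>"
    and rc: "128 * K\<^sup>2 * r \<le> c\<^sup>2" "64 * K * e \<le> c\<^sup>2"
  proof (cases "?\<Sigma> = {}")
    case True
    \<comment> \<open>The summand 1 makes \<open>c \<le> c\<^sup>2\<close>; with r = 1 the other two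
      dominate the left sides of \<open>rc\<close>.\<close>
    define c where "c = 128 * K\<^sup>2 + 64 * K * e + 1"
    have "1 \<le> c" "128 * K\<^sup>2 * 1 \<le> c" "64 * K * e \<le> c" using K_pos e(2) by (auto simp: c_def)
    moreover from this have "c \<le> c\<^sup>2" by (simp add: power2_eq_square)
    ultimately show ?thesis
      using True by (intro that[of c 1]) (auto simp: dist_set_def top_ereal_def)
  next
    case False
    then obtain s\<^sub>0 where s0: "s\<^sub>0 \<in> ?\<Sigma>" by blast
    have sigma_nonneg: "0 \<le> sigma_min (hessian B f s)" for s by (rule sigma_min_ge) simp
    have "0 \<le> \<gamma>" unfolding \<gamma> by (intro INF_greatest) (simp add: sigma_nonneg)
    moreover have \<gamma>_le: "\<gamma> \<le> ereal (sigma_min (hessian B f s))" if "s \<in> ?\<Sigma>" for s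
      unfolding \<gamma> by (rule INF_lower[OF that])
    ultimately obtain c where c: "\<gamma> = ereal c" "0 \<le> c" using s0 by (cases \<gamma>) fastforce+
    have e_c: "e < c\<^sup>2 / (64 * K)" using e_less(2) K_pos by (simp add: c)
    \<comment> \<open>Positivity of \<open>\<gamma>\<close> comes from e >= 0 lying strictly below
      c^2 / (64 K).\<close>
    then have "c \<noteq> 0" using e(2) by auto
    \<comment> \<open>Otherwise the critical point \<open>s\<^sub>0\<close> itself would compete in
      the infimum defining \<open>\<eta>\<close>, forcing \<open>\<eta>\<close> <= 0.\<close>
    have "0 < \<rho>"
    proof (rule ccontr)
      assume "\<not> 0 < \<rho>"
      moreover have "0 \<le> dist_set s\<^sub>0 ?\<Sigma>" unfolding dist_set_def by (intro INF_greatest) simp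
      ultimately have "\<eta> \<le> ereal (onorm (D_on B f s\<^sub>0))"
        unfolding \<eta> using s0 by (intro INF_lower) (auto simp: critical_points_def)
      then show False using s0 m by (simp add: critical_points_def onorm_zero)
    qed
    moreover have \<rho>_le: "\<rho> \<le> ereal (c\<^sup>2 / (128 * K\<^sup>2))" using K_pos by (simp add: \<rho> c)
    ultimately obtain r where r: "\<rho> = ereal r" "0 < r" by (cases \<rho>) auto
    show ?thesis
    proof (rule that[of c r])
      show "128 * K\<^sup>2 * r \<le> c\<^sup>2" "64 * K * e \<le> c\<^sup>2"
        using \<rho>_le e_c K_pos by (simp_all add: r field_simps)
      show "\<rho> \<le> dist_set y ?\<Sigma>" if "\<forall>s\<in>?\<Sigma>. r \<le> dist y s" for y
        unfolding dist_set_def r by (intro INF_greatest) (simp add: that)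
    qed (use c r \<gamma>_le \<open>c \<noteq> 0\<close> in auto)
  qed

  interpret morse_perturbation f g k K c r m e B
  proof
    show "8 * K * r \<le> \<bar>f s - f t\<bar>" if st: "s \<in> ?\<Sigma>" "t \<in> ?\<Sigma>" "s \<noteq> t" for s t
    proof -
      obtain i j where ij: "i \<in> {1..p}" "j \<in> {1..p}" "s = x i" "t = x j" "i \<noteq> j"
        using st crit(1) by (metis (full_types) imageE)
      then have "d \<le> ereal \<bar>f s - f t\<bar>"
        unfolding d min_gap_def by (intro INF_lower2[of "(i, j)"]) auto
      then have "d / ereal (8 * K) \<le> ereal \<bar>f s - f t\<bar> / ereal (8 * K)"
        using K_pos by (intro ereal_divide_right_mono) auto
      moreover have "\<rho> \<le> d / ereal (8 * K)" by (simp add: \<rho> min.coboundedI1 min.coboundedI2)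
      ultimately have "ereal r \<le> ereal \<bar>f s - f t\<bar> / ereal (8 * K)"
        using r(2) st(1) by (metis empty_iff order_trans)
      then show ?thesis using K_pos by (simp add: field_simps)
    qed
    show "norm s + r \<le> 1" if s: "s \<in> ?\<Sigma>" for s
    proof -
      \<comment> \<open>The boundary point nearest to s, on the ray from 0 through s; for s = 0 any
        boundary point has distance 1.\<close>
      define y where "y = (if s = 0 then ?b else s /\<^sub>R norm s)"
      have y: "y \<in> sphere 0 1" by (simp add: y_def)
      have "ereal r = \<rho>" using r(2) s by auto
      also have "\<rho> \<le> dist_sets ?\<Sigma> (sphere 0 1)" by (simp add: \<rho> min.coboundedI2)
      also have "\<dots> \<le> dist_set s (sphere 0 1)" unfolding dist_sets_def by (rule INF_lower[OF s])
      also have "\<dots> \<le> ereal (dist s y)" unfolding dist_set_def by (rule INF_lower[OF y])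
      finally have "r \<le> dist s y" by simp
      also have "dist s y = 1 - norm s"
      proof (cases "s = 0")
        case False
        have "norm s < 1" using s \<Sigma>_ball by auto
        have "s - y = (norm s - 1) *\<^sub>R (s /\<^sub>R norm s)" using False by (simp add: y_def algebra_simps)
        then have "norm (s - y) = \<bar>norm s - 1\<bar> * norm (s /\<^sub>R norm s)" by (metis norm_scaleR)
        then show ?thesis using False \<open>norm s < 1\<close> by (simp add: dist_norm)
      qed (simp add: y_def)
      finally show ?thesis by simp
    qed
    show "m \<le> onorm (D_on B f y)" if y: "y \<in> B" "\<And>s. s \<in> ?\<Sigma> \<Longrightarrow> r \<le> dist y s" for y
    proof -
      have "\<eta> \<le> ereal (onorm (D_on B f y))"
        unfolding \<eta> using y r(3) by (intro INF_lower) auto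
      then show ?thesis by (simp add: m)
    qed
      show "Ck_norm k B ?h \<le> ereal e" by (simp add: e)
  qed fact+

  have sigma_half: "ereal (sigma_min (hessian B g y)) \<ge> \<gamma> / 2"
    if "s \<in> ?\<Sigma>" "dist y s < r" for s y
  proof -
    have "\<gamma> = ereal c" using c(3) that(1) by blast
    then show ?thesis using sigma_min_hessian_g_ge[OF that(1), of y] that(2) by simp
  qed
  note near = near_of_critical_point[OF _ m(2)]

  have i: "\<forall>y\<in>ball 0 1. ereal (onorm (D_on B g y)) < \<eta> / 2 \<longrightarrow> ereal (sigma_min (hessian B g y)) \<ge> \<gamma> / 2"
  proof (intro ballI impI)
    fix y :: "real^'n" assume "y \<in> ball 0 1" "ereal (onorm (D_on B g y)) < \<eta> / 2"
    then have "y \<in> B" "onorm (D_on B g y) < m / 2" by (simp_all add: B m)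
    then obtain s where "s \<in> ?\<Sigma>" "dist y s < r" using near_critical_point by blast
    then show "ereal (sigma_min (hessian B g y)) \<ge> \<gamma> / 2" by (rule sigma_half)
  qed
  have morse: "morse_on B g"
    unfolding morse_on_def
  proof
    fix y assume "y \<in> critical_points B g"
    then obtain s where "s \<in> ?\<Sigma>" "dist y s < r" using near by blast
    then show "sigma_min (hessian B g y) > 0" using sigma_min_hessian_g_ge[of s y] c(1) by simp
  qed

  have "\<forall>i\<in>{1..p}. \<exists>z. z \<in> critical_points B g \<and> dist z (x i) < r"
    using critical_point_g_exists crit(1) by blast
  then obtain z where z: "\<And>i. i \<in> {1..p} \<Longrightarrow> z i \<in> critical_points B g \<and> dist (z i) (x i) < r"
    by (metis bchoice)
  have x: "x i \<in> ?\<Sigma>" if "i \<in> {1..p}" for i using crit(1) that by blast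
  have gap: "\<bar>f (x i) - f (x j)\<bar> / 2 \<le> \<bar>g (z i) - g (z j)\<bar>"
    if "i \<in> {1..p}" "j \<in> {1..p}" "i \<noteq> j" for i j
  proof (rule critical_value_gap)
    show "x i \<noteq> x j" using distinct_values[OF that] by metis
  qed (use x z that critical_points_in_B(2) in auto)
  \<comment> \<open>If z i = z j, the gap of g vanishes, hence also that of f, against the distinct
    critical values.\<close>
  have "inj_on z {1..p}"
  proof (rule inj_onI, rule ccontr)
    fix i j assume ij: "i \<in> {1..p}" "j \<in> {1..p}" "z i = z j" "i \<noteq> j"
    then show False using gap[of i j] distinct_values[of i j] by simp
  qed
  moreover have "critical_points B g = z ` {1..p}"
  proof
    show "z ` {1..p} \<subseteq> critical_points B g" using z by blast
    show "critical_points B g \<subseteq> z ` {1..p}"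
    proof
      fix y assume y: "y \<in> critical_points B g"
      then obtain i where i: "i \<in> {1..p}" "dist y (x i) < r"
        using near[OF y] crit(1) by auto
      then have "y = z i"
        using critical_point_g_unique[OF x[OF i(1)] y] z[OF i(1)] by simp
      then show "y \<in> z ` {1..p}" using i(1) by blast
    qed
  qed
  moreover have "z ` {1..p} \<subseteq> ball 0 1"
    using near_in_ball x z by blast
  moreover have "\<forall>i\<in>{1..p}. ereal (norm (z i - x i)) < \<rho>"
  proof
    fix i assume i: "i \<in> {1..p}"
    then have "\<rho> = ereal r" using r(2) x by blast
    then show "ereal (norm (z i - x i)) < \<rho>" using z[OF i] by (simp add: dist_norm)
  qed
  moreover have "\<forall>i\<in>{1..p}. ereal (sigma_min (hessian B g (z i))) \<ge> \<gamma> / 2"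
    using sigma_half x z by blast
  moreover have "min_gap g z p \<ge> d / 2"
    unfolding min_gap_def
  proof (rule INF_greatest, clarify)
    fix i j assume ij: "i \<in> {1..p}" "j \<in> {1..p}" "i \<noteq> j"
    then have "d \<le> ereal \<bar>f (x i) - f (x j)\<bar>"
      unfolding d min_gap_def by (intro INF_lower2[of "(i, j)"]) auto
    then have "d / 2 \<le> ereal \<bar>f (x i) - f (x j)\<bar> / 2"
      by (intro ereal_divide_right_mono) auto
    also have "\<dots> \<le> ereal \<bar>g (z i) - g (z j)\<bar>" using gap[OF ij] by simp
    finally show "d / 2 \<le> ereal \<bar>g (z i) - g (z j)\<bar>" .
  qed
  ultimately show "(\<forall>y\<in>ball 0 1. ereal (onorm (D_on B g y)) < \<eta> / 2 \<longrightarrow>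
        ereal (sigma_min (hessian B g y)) \<ge> \<gamma> / 2) \<and>
    morse_on B g \<and>
    (\<exists>z :: nat \<Rightarrow> real^'n.
        inj_on z {1..p} \<and>
        critical_points B g = z ` {1..p} \<and> z ` {1..p} \<subseteq> ball 0 1 \<and>
        (\<forall>i\<in>{1..p}. ereal (norm (z i - x i)) < \<rho>) \<and>
        (\<forall>i\<in>{1..p}. ereal (sigma_min (hessian B g (z i))) \<ge> \<gamma> / 2) \<and>
        min_gap g z p \<ge> d / 2)"
    using i morse by blast
qed

end
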